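(* Let $R$ be an integral domain which is not a field. Then $GD(R)$, endowed with the multiplication $[a][b]=[ab]$ for $a,b\in R^\#$, is a commutative topological semigroup.
   Context: For a commutative ring $R$ with nonzero identity and unit group $U(R)$, let $R^\#=R\setminus(U(R)\cup\{0\})$ be the set of nonzero nonunits. For $a,b\in R^\#$ write $a\sim b$ if $aR=bR$; $[a]$ denotes the equivalence class of $a$ and $EC(R^\#)$ the set of equivalence classes. For $a\in R^\#$ put $B_a=\{[b]\in EC(R^\#): b\mid a^n\text{ for some }n\geq 1\}$. The sets $B_a$ ($a\in R^\#$) form a basis of a topology on $EC(R^\#)$; the resulting space is denoted $GD(R)$ (the generalized divisor topology). A topological semigroup is a semigroup with a topology (no separation axiom assumed) for which multiplication is jointly continuous. *)

theory Defs
  imports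
    "HOL-Algebra.Ideal"
    "HOL-Algebra.Divisibility"
    "HOL-Analysis.Product_Topology"
begin

definition nonzero_nonunits :: "('a, 'm) ring_scheme \<Rightarrow> 'a set" where
  "nonzero_nonunits R = carrier R - (Units R \<union> {\<zero>\<^bsub>R\<^esub>})"

definition ideal_rel :: "('a, 'm) ring_scheme \<Rightarrow> ('a \<times> 'a) set" where
  "ideal_rel R = {(a, b). a \<in> nonzero_nonunits R \<and> b \<in> nonzero_nonunits R
                          \<and> PIdl\<^bsub>R\<^esub> a = PIdl\<^bsub>R\<^esub> b}"

definition EC :: "('a, 'm) ring_scheme \<Rightarrow> 'a set set" where
  "EC R = nonzero_nonunits R // ideal_rel R"

definition ec_class :: "('a, 'm) ring_scheme \<Rightarrow> 'a \<Rightarrow> 'a set" where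
  "ec_class R a = ideal_rel R `` {a}"

definition basic_nbhd :: "('a, 'm) ring_scheme \<Rightarrow> 'a \<Rightarrow> 'a set set" where
  "basic_nbhd R a = {ec_class R b | b. b \<in> nonzero_nonunits R
                       \<and> (\<exists>n::nat. n \<ge> 1 \<and> b divides\<^bsub>R\<^esub> (a [^]\<^bsub>R\<^esub> n))}"

definition GD :: "('a, 'm) ring_scheme \<Rightarrow> 'a set topology" where
  "GD R = topology (arbitrary union_of (\<lambda>U. \<exists>a\<in>nonzero_nonunits R. U = basic_nbhd R a))"

text \<open>
  The product of two classes, as the union of the classes of all products of representatives;
  it is the single class of \<open>a \<otimes> b\<close> exactly when this does not depend on the representatives.
\<close>

definition ec_mult :: "('a, 'm) ring_scheme \<Rightarrow> 'a set \<Rightarrow> 'a set \<Rightarrow> 'a set" where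
  "ec_mult R X Y = (\<Union>a\<in>X. \<Union>b\<in>Y. ec_class R (a \<otimes>\<^bsub>R\<^esub> b))"

text \<open>A semigroup has a nonempty underlying set; no separation axiom is imposed.\<close>

definition topological_semigroup :: "'b topology \<Rightarrow> ('b \<Rightarrow> 'b \<Rightarrow> 'b) \<Rightarrow> bool" where
  "topological_semigroup X f \<longleftrightarrow>
     topspace X \<noteq> {} \<and>
     (\<forall>x\<in>topspace X. \<forall>y\<in>topspace X. f x y \<in> topspace X) \<and>
     (\<forall>x\<in>topspace X. \<forall>y\<in>topspace X. \<forall>z\<in>topspace X. f (f x y) z = f x (f y z)) \<and>
     continuous_map (prod_topology X X) X (\<lambda>(x, y). f x y)"

definition commutative_topological_semigroup :: "'b topology \<Rightarrow> ('b \<Rightarrow> 'b \<Rightarrow> 'b) \<Rightarrow> bool" where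
  "commutative_topological_semigroup X f \<longleftrightarrow>
     topological_semigroup X f \<and> (\<forall>x\<in>topspace X. \<forall>y\<in>topspace X. f x y = f y x)"

text \<open>
  The family of the \<open>basic_nbhd R a\<close> is closed under the operations needed for a basis,
  so the opens of \<open>GD R\<close> are indeed its unions, and the underlying set is \<open>EC R\<close>.
\<close>

lemma (in cring) ideal_rel_divides:
  assumes "(a, b) \<in> ideal_rel R"
  shows "a divides b"
proof -
  have ab: "a \<in> carrier R" "b \<in> carrier R" "PIdl a = PIdl b"
    using assms by (auto simp: ideal_rel_def nonzero_nonunits_def)
  have "b \<in> PIdl a"
    using ab cgenideal_self by simp
  then obtain c where "c \<in> carrier R" "b = c \<otimes> a"
    by (auto simp: cgenideal_def)
  then show ?thesis
    using ab m_comm by (auto simp: factor_def)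
qed

lemma (in cring) equiv_ideal_rel: "equiv (nonzero_nonunits R) (ideal_rel R)"
  by (rule equivI) (auto simp: ideal_rel_def refl_on_def sym_def trans_def)

lemma (in cring) basic_nbhd_self:
  assumes "a \<in> nonzero_nonunits R"
  shows "ec_class R a \<in> basic_nbhd R a"
proof -
  have "a \<in> carrier R"
    using assms by (simp add: nonzero_nonunits_def)
  then have "a divides (a [^] (1::nat))"
    by (simp add: factor_def) (metis one_closed r_one)
  then show ?thesis
    using assms unfolding basic_nbhd_def by blast
qed

lemma (in cring) divides_pow:
  assumes "a \<in> carrier R" "b \<in> carrier R" "a divides b"
  shows "(a [^] (n::nat)) divides (b [^] n)"
proof -
  obtain c where "c \<in> carrier R" "b = a \<otimes> c"
    using assms by (auto simp: factor_def)
  then show ?thesis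
    using assms by (auto simp: factor_def nat_pow_distrib)
qed

lemma (in cring) basic_nbhd_minimal:
  assumes a: "a \<in> nonzero_nonunits R" and c: "c \<in> nonzero_nonunits R"
    and "ec_class R c \<in> basic_nbhd R a"
  shows "basic_nbhd R c \<subseteq> basic_nbhd R a"
proof
  fix X
  assume "X \<in> basic_nbhd R c"
  then obtain d m where d: "X = ec_class R d" "d \<in> nonzero_nonunits R" "(m::nat) \<ge> 1"
    "d divides (c [^] m)"
    by (auto simp: basic_nbhd_def)
  obtain b n where b: "ec_class R c = ec_class R b" "b \<in> nonzero_nonunits R" "(n::nat) \<ge> 1"
    "b divides (a [^] n)"
    using assms(3) by (auto simp: basic_nbhd_def)
  have carr: "a \<in> carrier R" "b \<in> carrier R" "c \<in> carrier R" "d \<in> carrier R"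
    using a b c d by (auto simp: nonzero_nonunits_def)
  have "(c, b) \<in> ideal_rel R"
    using b c by (auto simp: ec_class_def ideal_rel_def)
  then have "c divides b"
    by (rule ideal_rel_divides)
  then have "c divides (a [^] n)"
    using b carr by (meson divides_trans)
  then have "(c [^] m) divides (a [^] (n * m))"
    using carr divides_pow[of c "a [^] n" m] by (simp add: nat_pow_pow)
  then have "d divides (a [^] (n * m))"
    using d carr by (meson divides_trans)
  moreover have "n * m \<ge> 1"
    using b d by simp
  ultimately show "X \<in> basic_nbhd R a"
    using d unfolding basic_nbhd_def by blast
qed

lemma (in cring) openin_GD:
  "openin (GD R) = arbitrary union_of (\<lambda>U. \<exists>a\<in>nonzero_nonunits R. U = basic_nbhd R a)"
    (is "_ = arbitrary union_of ?P")
proof -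
  have "(arbitrary union_of ?P) (S \<inter> T)" if S: "?P S" and T: "?P T" for S T
  proof -
    obtain a b where ab: "a \<in> nonzero_nonunits R" "S = basic_nbhd R a"
      "b \<in> nonzero_nonunits R" "T = basic_nbhd R b"
      using S T by blast
    have "\<exists>U. ?P U \<and> X \<in> U \<and> U \<subseteq> S \<inter> T" if X: "X \<in> S \<inter> T" for X
    proof -
      obtain c where c: "X = ec_class R c" "c \<in> nonzero_nonunits R"
        using X ab by (auto simp: basic_nbhd_def)
      then show ?thesis
        using X ab basic_nbhd_self[of c] basic_nbhd_minimal[of a c] basic_nbhd_minimal[of b c]
        by blast
    qed
    then show ?thesis
      by (auto simp: arbitrary_union_of_alt)
  qed
  then have "istopology (arbitrary union_of ?P)"
    unfolding istopology_base_eq by blast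
  then show ?thesis
    by (simp add: GD_def topology_inverse')
qed

lemma (in cring) topspace_GD: "topspace (GD R) = EC R"
proof
  show "topspace (GD R) \<subseteq> EC R"
  proof
    fix X
    assume "X \<in> topspace (GD R)"
    then obtain U where "openin (GD R) U" "X \<in> U"
      by (auto simp: topspace_def)
    then obtain a where "X \<in> basic_nbhd R a"
      by (auto simp: openin_GD arbitrary_union_of_alt)
    then show "X \<in> EC R"
      by (auto simp: basic_nbhd_def EC_def ec_class_def intro: quotientI)
  qed
  show "EC R \<subseteq> topspace (GD R)"
  proof
    fix X
    assume "X \<in> EC R"
    then obtain a where a: "a \<in> nonzero_nonunits R" "X = ec_class R a"
      by (auto simp: EC_def ec_class_def elim: quotientE)
    then have "openin (GD R) (basic_nbhd R a)"
      by (auto simp: openin_GD intro: arbitrary_union_of_inc)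
    then show "X \<in> topspace (GD R)"
      using a basic_nbhd_self openin_subset by blast
  qed
qed

end

theory Submission
  imports Defs "HOL-Algebra.Ring_Divisibility"
begin

text \<open>
  Two facts about divisibility carry the proof. First, \<open>PIdl a = PIdl b\<close> means that \<open>a\<close> and
  \<open>b\<close> divide each other, and divisibility is compatible with products; hence \<open>[a][b] = [ab]\<close>
  does not depend on the representatives (\<open>ec_mult_ec_class\<close>), and the multiplication of classes
  inherits associativity and commutativity from the ring. A domain is what keeps \<open>ab\<close> nonzero,
  and a domain that is not a field is what makes the set of classes nonempty.

  Second, \<open>basic_nbhd R a\<close> is the smallest open set containing \<open>[a]\<close>
  (\<open>openin_GD_basic_nbhd_subset\<close>). Continuity at \<open>([a], [b])\<close> therefore reduces to one inclusion:
  the product of \<open>basic_nbhd R a\<close> and \<open>basic_nbhd R b\<close> lies in \<open>basic_nbhd R (ab)\<close>. If \<open>c\<close>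
  divides \<open>a\<^sup>n\<close> and \<open>d\<close> divides \<open>b\<^sup>m\<close>, then \<open>cd\<close> divides \<open>a\<^sup>nb\<^sup>m\<close>, which divides
  \<open>(ab)\<^bsup>n+m\<^esup>\<close> (\<open>ec_mult_basic_nbhd\<close>).
\<close>

lemma (in cring) ideal_rel_iff_associated:
  assumes "a \<in> nonzero_nonunits R" "b \<in> nonzero_nonunits R"
  shows "(a, b) \<in> ideal_rel R \<longleftrightarrow> a \<sim> b"
  using assms associated_iff_same_ideal[of a b]
  by (auto simp: ideal_rel_def nonzero_nonunits_def)

lemma (in cring) divides_mult_mono:
  assumes "a \<in> carrier R" "b \<in> carrier R" "c \<in> carrier R" "d \<in> carrier R"
    and "a divides c" "b divides d"
  shows "(a \<otimes> b) divides (c \<otimes> d)"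
proof -
  obtain u v where "u \<in> carrier R" "c = a \<otimes> u" "v \<in> carrier R" "d = b \<otimes> v"
    using assms by (auto simp: factor_def)
  then have "c \<otimes> d = (a \<otimes> b) \<otimes> (u \<otimes> v)" "u \<otimes> v \<in> carrier R"
    using assms by (simp_all add: m_ac)
  then show ?thesis
    by (auto simp: factor_def)
qed

lemma (in domain) nonzero_nonunits_mult:
  assumes "a \<in> nonzero_nonunits R" "b \<in> nonzero_nonunits R"
  shows "a \<otimes> b \<in> nonzero_nonunits R"
proof -
  have "a \<in> carrier R" "b \<in> carrier R" "a \<notin> Units R" "a \<noteq> \<zero>" "b \<noteq> \<zero>"
    using assms by (auto simp: nonzero_nonunits_def)
  moreover from this have "a \<otimes> b \<notin> Units R"
    using unit_factor[of a b] by blast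
  ultimately show ?thesis
    by (auto simp: nonzero_nonunits_def integral_iff)
qed

lemma (in domain) nonzero_nonunits_nonempty:
  assumes "\<not> field R"
  shows "nonzero_nonunits R \<noteq> {}"
proof
  assume "nonzero_nonunits R = {}"
  then have "carrier R - {\<zero>} \<subseteq> Units R"
    by (auto simp: nonzero_nonunits_def)
  moreover have "Units R \<subseteq> carrier R - {\<zero>}"
    using zero_is_prime(1) one_not_zero by (auto simp: Units_def)
  ultimately have "field R"
    by (intro cring_fieldI) blast
  with assms show False ..
qed

lemma (in cring) EC_eq_image: "EC R = ec_class R ` nonzero_nonunits R"
  by (auto simp: EC_def ec_class_def quotient_def)

text \<open>
  Replacing \<open>a\<close> and \<open>b\<close> by associated elements replaces \<open>a \<otimes> b\<close> by an associated element, so the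
  union defining \<open>ec_mult\<close> ranges over copies of one class.
\<close>

lemma (in domain) ec_mult_ec_class:
  assumes a: "a \<in> nonzero_nonunits R" and b: "b \<in> nonzero_nonunits R"
  shows "ec_mult R (ec_class R a) (ec_class R b) = ec_class R (a \<otimes> b)"
proof -
  have "ec_class R (c \<otimes> d) = ec_class R (a \<otimes> b)"
    if "c \<in> ec_class R a" "d \<in> ec_class R b" for c d
  proof -
    have rel: "(a, c) \<in> ideal_rel R" "(b, d) \<in> ideal_rel R"
      using that by (auto simp: ec_class_def)
    then have cd: "c \<in> nonzero_nonunits R" "d \<in> nonzero_nonunits R"
      by (auto simp: ideal_rel_def)
    have carr: "a \<in> carrier R" "b \<in> carrier R" "c \<in> carrier R" "d \<in> carrier R"
      using a b cd by (auto simp: nonzero_nonunits_def)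
    have "a \<sim> c" "b \<sim> d"
      using rel a b cd ideal_rel_iff_associated by auto
    then have "(a \<otimes> b) \<sim> (c \<otimes> d)"
      using carr divides_mult_mono by (simp add: associated_def)
    then have "(a \<otimes> b, c \<otimes> d) \<in> ideal_rel R"
      using a b cd nonzero_nonunits_mult ideal_rel_iff_associated by blast
    then show ?thesis
      unfolding ec_class_def using equiv_class_eq[OF equiv_ideal_rel] by metis
  qed
  moreover have "a \<in> ec_class R a" "b \<in> ec_class R b"
    using a b by (auto simp: ec_class_def ideal_rel_def)
  ultimately show ?thesis
    unfolding ec_mult_def by blast
qed

lemma (in cring) openin_basic_nbhd:
  "a \<in> nonzero_nonunits R \<Longrightarrow> openin (GD R) (basic_nbhd R a)"
  by (auto simp: openin_GD intro: arbitrary_union_of_inc)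

text \<open>
  Some basic set between the point and \<open>U\<close> exists because the sets \<open>basic_nbhd R c\<close> form a basis;
  transitivity of divisibility up to powers then places \<open>basic_nbhd R a\<close> inside it.
\<close>

lemma (in cring) openin_GD_basic_nbhd_subset:
  assumes "openin (GD R) U" "a \<in> nonzero_nonunits R" "ec_class R a \<in> U"
  shows "basic_nbhd R a \<subseteq> U"
proof -
  obtain c where "c \<in> nonzero_nonunits R" "ec_class R a \<in> basic_nbhd R c" "basic_nbhd R c \<subseteq> U"
    using assms by (auto simp: openin_GD arbitrary_union_of_alt)
  then show ?thesis
    using basic_nbhd_minimal assms by blast
qed

text \<open>
  The cofactor of \<open>a\<^sup>nb\<^sup>m\<close> in \<open>(ab)\<^bsup>n+m\<^esup>\<close> is \<open>a\<^sup>mb\<^sup>n\<close>; the exponent \<open>n + m\<close> serves both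
  factors at once.
\<close>

lemma (in domain) ec_mult_basic_nbhd:
  assumes a: "a \<in> nonzero_nonunits R" and b: "b \<in> nonzero_nonunits R"
    and X: "X \<in> basic_nbhd R a" and Y: "Y \<in> basic_nbhd R b"
  shows "ec_mult R X Y \<in> basic_nbhd R (a \<otimes> b)"
proof -
  obtain c n where c: "X = ec_class R c" "c \<in> nonzero_nonunits R" "(n::nat) \<ge> 1"
    "c divides (a [^] n)"
    using X by (auto simp: basic_nbhd_def)
  obtain d m where d: "Y = ec_class R d" "d \<in> nonzero_nonunits R" "(m::nat) \<ge> 1"
    "d divides (b [^] m)"
    using Y by (auto simp: basic_nbhd_def)
  have carr: "a \<in> carrier R" "b \<in> carrier R" "c \<in> carrier R" "d \<in> carrier R"
    using a b c d by (auto simp: nonzero_nonunits_def)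
  have "(c \<otimes> d) divides (a [^] n \<otimes> b [^] m)"
    using carr c d divides_mult_mono by simp
  moreover have "(a \<otimes> b) [^] (n + m) = (a [^] n \<otimes> b [^] m) \<otimes> (a [^] m \<otimes> b [^] n)"
    using carr by (simp add: nat_pow_distrib nat_pow_mult[symmetric] m_ac)
  ultimately have "(c \<otimes> d) divides ((a \<otimes> b) [^] (n + m))"
    using carr by (simp add: divides_prod_r)
  moreover have "n + m \<ge> 1"
    using c by simp
  ultimately show ?thesis
    unfolding c(1) d(1) ec_mult_ec_class[OF c(2) d(2)] basic_nbhd_def
    using nonzero_nonunits_mult[OF c(2) d(2)] by blast
qed

lemma (in domain) continuous_map_ec_mult:
  "continuous_map (prod_topology (GD R) (GD R)) (GD R) (\<lambda>(X, Y). ec_mult R X Y)"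
  unfolding continuous_map_eq_topcontinuous_at topcontinuous_at_def
proof (intro ballI conjI allI impI)
  fix p
  assume "p \<in> topspace (prod_topology (GD R) (GD R))"
  then obtain a b where ab: "p = (ec_class R a, ec_class R b)"
    "a \<in> nonzero_nonunits R" "b \<in> nonzero_nonunits R"
    by (auto simp: topspace_GD EC_eq_image)
  then show "p \<in> topspace (prod_topology (GD R) (GD R))"
    by (auto simp: topspace_GD EC_eq_image)
  show "(\<lambda>(X, Y). ec_mult R X Y) \<in> topspace (prod_topology (GD R) (GD R)) \<rightarrow> topspace (GD R)"
    by (auto simp: topspace_GD EC_eq_image ec_mult_ec_class nonzero_nonunits_mult)
  fix V
  assume V: "openin (GD R) V \<and> (case p of (X, Y) \<Rightarrow> ec_mult R X Y) \<in> V"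
  then have "basic_nbhd R (a \<otimes> b) \<subseteq> V"
    using ab by (intro openin_GD_basic_nbhd_subset)
      (auto simp: ec_mult_ec_class nonzero_nonunits_mult)
  then have "\<forall>q\<in>basic_nbhd R a \<times> basic_nbhd R b. (case q of (X, Y) \<Rightarrow> ec_mult R X Y) \<in> V"
    using ec_mult_basic_nbhd[OF ab(2,3)] by auto
  moreover have "openin (prod_topology (GD R) (GD R)) (basic_nbhd R a \<times> basic_nbhd R b)"
    using ab by (simp add: openin_prod_Times_iff openin_basic_nbhd)
  moreover have "p \<in> basic_nbhd R a \<times> basic_nbhd R b"
    using ab basic_nbhd_self by simp
  ultimately show "\<exists>U. openin (prod_topology (GD R) (GD R)) U \<and> p \<in> U \<and>
      (\<forall>q\<in>U. (case q of (X, Y) \<Rightarrow> ec_mult R X Y) \<in> V)"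
    by (intro exI conjI)
qed

theorem theorem5p2:
  fixes R :: "('a, 'm) ring_scheme"
  assumes "domain R" and "\<not> field R"
  shows "(\<forall>a\<in>nonzero_nonunits R. \<forall>b\<in>nonzero_nonunits R.
            a \<otimes>\<^bsub>R\<^esub> b \<in> nonzero_nonunits R \<and>
            ec_mult R (ec_class R a) (ec_class R b) = ec_class R (a \<otimes>\<^bsub>R\<^esub> b))
       \<and> commutative_topological_semigroup (GD R) (ec_mult R)"
proof -
  interpret domain R by fact
  have carr: "a \<in> carrier R" if "a \<in> nonzero_nonunits R" for a
    using that by (simp add: nonzero_nonunits_def)
  have "commutative_topological_semigroup (GD R) (ec_mult R)"
    unfolding commutative_topological_semigroup_def topological_semigroup_def topspace_GD EC_eq_image
    using nonzero_nonunits_nonempty[OF assms(2)] continuous_map_ec_mult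
    by (auto simp: ec_mult_ec_class nonzero_nonunits_mult carr m_ac)
  then show ?thesis
    by (simp add: ec_mult_ec_class nonzero_nonunits_mult)
qed

end
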